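(* Let $E$ be a Hilbert space with norm $\|\cdot\|$, let $\mathcal{I}:E\to\mathbb{R}$ be of class $C^1$, let $\mathcal{J}(u)=\frac12\|u\|^2-\mathcal{I}(u)$ for $u\in E$, and let $$\mathcal{N}=\{u\in E\setminus\{0\}:\ \mathcal{J}'(u)(u)=0\}=\{u\in E\setminus\{0\}:\ \|u\|^2=\mathcal{I}'(u)(u)\}.$$ Suppose that the following conditions hold: - (J1) there is $r>0$ such that $a:=\inf_{\|u\|=r}\mathcal{J}(u)>\mathcal{J}(0)=0$; - (J2) there is $q\ge 2$ such that $\mathcal{I}(t_nu_n)/t_n^q\to\infty$ for any $t_n\to\infty$ and $u_n\to u\ne 0$ as $n\to\infty$; - (J3) for $t\in(0,\infty)\setminus\{1\}$ and $u\in\mathcal{N}$, $$\frac{t^2-1}{2}\mathcal{I}'(u)(u)-\mathcal{I}(tu)+\mathcal{I}(u)<0;$$ - (J4) $\mathcal{J}$ is coercive on $\mathcal{N}$. Then $\inf_{\mathcal{N}}\mathcal{J}>0$ and there exists a bounded minimizing sequence for $\mathcal{J}$ on $\mathcal{N}$, i.e. there is a bounded sequence $(u_n)\subset\mathcal{N}$ such that $\mathcal{J}(u_n)\to\inf_{\mathcal{N}}\mathcal{J}$ and $\mathcal{J}'(u_n)\to 0$.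
   Context: $E$ is a real Hilbert space. $\mathcal{J}$ is coercive on $\mathcal{N}$ means: $\mathcal{J}(u_n)\to\infty$ for every sequence $(u_n)\subset\mathcal{N}$ with $\|u_n\|\to\infty$. Convergence $\mathcal{J}'(u_n)\to 0$ is in the norm of the dual space $E^*$. In (J2), $u_n\to u$ is convergence in the norm of $E$. *)

theory Defs
  imports "HOL-Analysis.Analysis"
begin

text \<open>The Frechet derivative as an element of the space of bounded linear maps, so that its norm is
  the operator norm; for real-valued functions, this is the norm of the dual space. The value is
  meaningful only at points of differentiability.\<close>
definition fderiv ::
  "('a::real_normed_vector \<Rightarrow> 'b::real_normed_vector) \<Rightarrow> 'a \<Rightarrow> 'a \<Rightarrow>\<^sub>L 'b" where
  "fderiv f u = Blinfun (frechet_derivative f (at u))"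

definition C1 :: "('a::real_normed_vector \<Rightarrow> 'b::real_normed_vector) \<Rightarrow> bool" where
  "C1 f \<longleftrightarrow> (\<forall>u. f differentiable (at u)) \<and> continuous_on UNIV (fderiv f)"

definition energy :: "('a::real_inner \<Rightarrow> real) \<Rightarrow> 'a \<Rightarrow> real" where
  "energy I u = 1/2 * (norm u)\<^sup>2 - I u"

definition nehari :: "('a::real_normed_vector \<Rightarrow> real) \<Rightarrow> 'a set" where
  "nehari J = {u. u \<noteq> 0 \<and> blinfun_apply (fderiv J u) u = 0}"

definition coercive_on :: "('a::real_normed_vector \<Rightarrow> real) \<Rightarrow> 'a set \<Rightarrow> bool" where
  "coercive_on J N \<longleftrightarrow>
     (\<forall>u :: nat \<Rightarrow> 'a. (\<forall>n. u n \<in> N) \<longrightarrow> filterlim (\<lambda>n. norm (u n)) at_top sequentially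
        \<longrightarrow> filterlim (\<lambda>n. J (u n)) at_top sequentially)"

lemma fderiv_eq:
  assumes "(f has_derivative f') (at u)"
  shows "blinfun_apply (fderiv f u) = f'"
  unfolding fderiv_def frechet_derivative_at[OF assms, symmetric]
  using assms by (intro bounded_linear_Blinfun_apply has_derivative_bounded_linear)

lemma fderiv_energy:
  fixes I :: "'a::real_inner \<Rightarrow> real"
  assumes "C1 I"
  shows "blinfun_apply (fderiv (energy I) u) v = u \<bullet> v - blinfun_apply (fderiv I u) v"
proof -
  have "I differentiable (at u)" using assms by (simp add: C1_def)
  then have I: "(I has_derivative frechet_derivative I (at u)) (at u)"
    by (simp add: frechet_derivative_works)
  have "(energy I has_derivative (\<lambda>v. u \<bullet> v - blinfun_apply (fderiv I u) v)) (at u)"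
    unfolding energy_def[abs_def] power2_norm_eq_inner fderiv_eq[OF I]
    by (auto intro!: derivative_eq_intros I simp: inner_commute)
  from fderiv_eq[OF this] show ?thesis by simp
qed

lemma nehari_energy:
  fixes I :: "'a::real_inner \<Rightarrow> real"
  assumes "C1 I"
  shows "nehari (energy I) = {u. u \<noteq> 0 \<and> (norm u)\<^sup>2 = blinfun_apply (fderiv I u) u}"
  by (auto simp: nehari_def fderiv_energy[OF assms] power2_norm_eq_inner)

end

theory Submission
  imports Defs
begin

text \<open>Every ray through a point other than the origin meets the Nehari manifold in exactly one point
  \<open>\<tau> u *\<^sub>R u\<close>, the global maximum of \<open>J\<close> on that ray, so minimizing \<open>J\<close> on the manifold is the same as
  minimizing \<open>\<Psi> u = J (\<tau> u *\<^sub>R u)\<close> on the unit sphere. Ekeland's principle on the sphere yields almost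
  minimizers \<open>u\<close> with \<open>\<Psi> v \<ge> \<Psi> u - \<epsilon> * dist u v\<close>. Since \<open>\<Psi> u \<ge> J (t *\<^sub>R u)\<close> for every \<open>t \<ge> 0\<close>, the
  difference \<open>\<Psi> v - \<Psi> u\<close> is at most \<open>J (t *\<^sub>R v) - J (t *\<^sub>R u)\<close> with \<open>t = \<tau> v\<close>; hence continuity of \<open>\<tau>\<close>
  suffices to bound the derivative of \<open>J\<close> at \<open>\<tau> u *\<^sub>R u\<close> by a multiple of \<open>\<epsilon>\<close>, and \<open>\<Psi>\<close> need not be
  differentiated. Coercivity bounds the minimizing sequence.\<close>

section \<open>Ekeland's variational principle and the unit sphere\<close>

text \<open>Membership \<open>y \<in> L x\<close> is a partial order on \<open>S\<close> in which
  every move is paid for by a decrease of \<open>f\<close>. A greedy descending sequence therefore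
  converges, and its limit is minimal for this order.\<close>

lemma ekeland_variational_principle:
  fixes f :: "'a::metric_space \<Rightarrow> real"
  assumes S: "complete S" and f: "continuous_on S f"
    and lower: "\<And>x. x \<in> S \<Longrightarrow> c \<le> f x"
    and x0: "x0 \<in> S" and e: "e > 0"
  obtains x where "x \<in> S" "f x \<le> f x0" "\<And>y. y \<in> S \<Longrightarrow> f x \<le> f y + e * dist x y"
proof -
  define L where "L x = {y \<in> S. f y + e * dist x y \<le> f x}" for x
  have L_self: "x \<in> L x" if "x \<in> S" for x
    using that by (simp add: L_def)
  have L_trans: "z \<in> L x" if "y \<in> L x" "z \<in> L y" for x y z
  proof -
    have "e * dist x z \<le> e * dist x y + e * dist y z"
      using e dist_triangle[of x z y] by (simp flip: distrib_left)
    then show ?thesis using that by (auto simp: L_def)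
  qed
  have bdd: "bdd_below (f ` L x)" for x
    using lower by (auto simp: L_def intro!: bdd_belowI[of _ c])
  have "\<exists>y \<in> L x. f y < Inf (f ` L x) + inverse (real (Suc n))" if "x \<in> S" for x n
  proof -
    have "f ` L x \<noteq> {}" using L_self[OF that] by auto
    from cInf_lessD[OF this, of "Inf (f ` L x) + inverse (real (Suc n))"]
    show ?thesis by auto
  qed
  \<comment> \<open>Each term nearly minimizes \<open>f\<close> over the set \<open>L\<close> of its
    predecessor, with errors tending to 0. The clause \<open>n = 0 \<longrightarrow> x = x0\<close>
    fixes the starting point of the dependent choice.\<close>
  then have "\<exists>s. s 0 = x0 \<and> (\<forall>n. s n \<in> S \<and> s (Suc n) \<in> L (s n)
      \<and> f (s (Suc n)) < Inf (f ` L (s n)) + inverse (real (Suc n)))"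
    using x0 dependent_nat_choice[of "\<lambda>n x. x \<in> S \<and> (n = 0 \<longrightarrow> x = x0)"
        "\<lambda>n x y. y \<in> L x \<and> f y < Inf (f ` L x) + inverse (real (Suc n))"]
    by (auto simp: L_def)
  then obtain s where s0: "s 0 = x0" and sS: "\<And>n. s n \<in> S" and sL: "\<And>n. s (Suc n) \<in> L (s n)"
    and sI: "\<And>n. f (s (Suc n)) < Inf (f ` L (s n)) + inverse (real (Suc n))"
    by blast
  have sL': "s n \<in> L (s m)" if "m \<le> n" for m n
    using that
  proof (induction n rule: dec_induct)
    case base
    show ?case by (rule L_self[OF sS])
  next
    case (step n)
    show ?case by (rule L_trans[OF step.IH sL])
  qed
  then have dist_s: "e * dist (s m) (s n) \<le> f (s m) - f (s n)" if "m \<le> n" for m n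
    using that by (force simp: L_def)
  have "decseq (\<lambda>n. f (s n))"
  proof (rule decseq_SucI)
    fix n
    have "0 \<le> e * dist (s n) (s (Suc n))" using e by simp
    then show "f (s (Suc n)) \<le> f (s n)" using dist_s[of n "Suc n"] by simp
  qed
  moreover have "\<forall>n. c \<le> f (s n)" using lower sS by blast
  ultimately obtain l where l: "(\<lambda>n. f (s n)) \<longlonglongrightarrow> l" "\<forall>n. l \<le> f (s n)"
    by (rule decseq_convergent)
  have "Cauchy s"
  proof (rule metric_CauchyI)
    fix d :: real assume d: "d > 0"
    have "\<forall>\<^sub>F n in sequentially. f (s n) < l + e * d / 2"
      using l(1) d e by (intro order_tendstoD(2)) auto
    then obtain M where M: "f (s M) < l + e * d / 2"
      by (auto simp: eventually_sequentially)
    have near: "dist (s M) (s n) < d / 2" if "M \<le> n" for n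
    proof -
      have "e * dist (s M) (s n) < e * (d / 2)"
        using dist_s[OF that] M l(2)[rule_format, of n] by (simp add: algebra_simps)
      then show ?thesis using e by simp
    qed
    show "\<exists>M. \<forall>m\<ge>M. \<forall>n\<ge>M. dist (s m) (s n) < d"
      using near by (blast intro: dist_triangle_half_r)
  qed
  then obtain x where x: "x \<in> S" "s \<longlonglongrightarrow> x"
    using S sS by (meson complete_def)
  have fs: "(\<lambda>n. f (s n)) \<longlonglongrightarrow> f x"
    using continuous_on_tendsto_compose[OF f x(2,1)] sS by simp
  have xL: "x \<in> L (s n)" for n
  proof -
    have "f x + e * dist (s n) x \<le> f (s n)"
    proof (rule tendsto_upperbound)
      show "((\<lambda>k. f (s k) + e * dist (s n) (s k)) \<longlongrightarrow> f x + e * dist (s n) x) sequentially"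
        by (intro tendsto_intros fs x)
      show "\<forall>\<^sub>F k in sequentially. f (s k) + e * dist (s n) (s k) \<le> f (s n)"
        using eventually_ge_at_top[of n] by eventually_elim (use dist_s in force)
    qed simp
    with x show ?thesis by (simp add: L_def)
  qed
  \<comment> \<open>By transitivity \<open>y\<close> lies in every \<open>L (s n)\<close>, so
    \<open>f y\<close> is at least each of the infima, which the values \<open>f (s (Suc n))\<close>
    exceed by less than the vanishing errors.\<close>
  have min: "f x \<le> f y" if y: "y \<in> L x" for y
  proof (rule tendsto_upperbound)
    show "((\<lambda>n. f (s (Suc n)) - inverse (real (Suc n))) \<longlongrightarrow> f x) sequentially"
      using tendsto_diff[OF LIMSEQ_Suc[OF fs] LIMSEQ_inverse_real_of_nat] by simp
    have "f (s (Suc n)) - inverse (real (Suc n)) \<le> f y" for n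
    proof -
      have "Inf (f ` L (s n)) \<le> f y"
        using L_trans[OF xL y] by (intro cInf_lower bdd) auto
      then show ?thesis using sI[of n] by simp
    qed
    then show "\<forall>\<^sub>F n in sequentially. f (s (Suc n)) - inverse (real (Suc n)) \<le> f y" by simp
  qed simp
  show thesis
  proof
    show "x \<in> S" by (rule x)
    have "0 \<le> e * dist x0 x" using e by simp
    then show "f x \<le> f x0" using xL[of 0] by (simp add: L_def s0)
    fix y assume y: "y \<in> S"
    show "f x \<le> f y + e * dist x y"
    proof (rule ccontr)
      assume *: "\<not> ?thesis"
      then have "f x \<le> f y" using y by (intro min) (simp add: L_def)
      moreover have "0 \<le> e * dist x y" using e by simp
      ultimately show False using * by simp
    qed
  qed
qed

text \<open>Projecting \<open>y\<close> radially moves it by the difference of the norms of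
  \<open>y\<close> and \<open>x\<close>, hence by at most \<open>dist x y\<close>. At the origin
  \<open>sgn 0 = 0\<close>, and the bound reads 1 \<le> 2.\<close>

lemma dist_sgn_le:
  fixes x y :: "'a::real_normed_vector"
  assumes "norm x = 1"
  shows "dist x (sgn y) \<le> 2 * dist x y"
proof (cases "y = 0")
  case True
  then show ?thesis using assms by (simp add: dist_norm)
next
  case False
  have "y - sgn y = (norm y - 1) *\<^sub>R sgn y"
    using False by (simp add: sgn_div_norm algebra_simps)
  then have "dist y (sgn y) = \<bar>norm y - norm x\<bar>"
    using False assms by (simp add: dist_norm norm_sgn)
  also have "\<dots> \<le> dist x y"
    using norm_triangle_ineq3[of y x] by (simp add: dist_norm norm_minus_commute)
  finally show ?thesis
    using dist_triangle[of x "sgn y" y] by simp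
qed

section \<open>Rays and the Nehari manifold\<close>

text \<open>The hypotheses are expressed through \<open>J\<close> alone: \<open>neg\<close> is what
  the growth of \<open>I\<close> provides, and \<open>ray_less\<close> is (J3). Completeness is not
  assumed here; it enters only through the unit sphere, when Ekeland's principle is applied.\<close>

locale nehari_functional =
  fixes J :: "'a::real_normed_vector \<Rightarrow> real" and r a :: real
  assumes C1: "C1 J"
    and zero: "J 0 = 0"
    and r: "r > 0" and a: "a > 0"
    and sphere: "\<And>u. norm u = r \<Longrightarrow> a \<le> J u"
    and neg: "\<And>t v u. filterlim t at_top sequentially \<Longrightarrow> v \<longlonglongrightarrow> u \<Longrightarrow> u \<noteq> 0 \<Longrightarrow>
      \<forall>\<^sub>F n in sequentially. J (t n *\<^sub>R v n) < 0"
    and ray_less: "\<And>u t. u \<in> nehari J \<Longrightarrow> t > 0 \<Longrightarrow> t \<noteq> 1 \<Longrightarrow> J (t *\<^sub>R u) < J u"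
begin

lemma deriv: "(J has_derivative blinfun_apply (fderiv J u)) (at u)"
proof -
  have "J differentiable (at u)" using C1 by (simp add: C1_def)
  then have J: "(J has_derivative frechet_derivative J (at u)) (at u)"
    by (simp add: frechet_derivative_works)
  then show ?thesis by (simp add: fderiv_eq[OF J])
qed

lemma isCont_J: "isCont J u"
  using deriv by (rule has_derivative_continuous)

lemma tendsto_J: "(f \<longlongrightarrow> u) F \<Longrightarrow> ((\<lambda>x. J (f x)) \<longlongrightarrow> J u) F"
  using isCont_J by (rule isCont_tendsto_compose)

text \<open>Turns the sequential condition \<open>neg\<close> into a threshold \<open>T\<close>
  common to all rays near \<open>u\<close>. If none existed, thresholds \<open>n\<close> and radii
  \<open>1/(n+1)\<close> would give a sequence violating \<open>neg\<close>.\<close>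

lemma locally_neg:
  assumes "u \<noteq> 0"
  shows "\<exists>T d. d > 0 \<and> (\<forall>x t. dist u x < d \<longrightarrow> t > T \<longrightarrow> J (t *\<^sub>R x) < 0)"
proof (rule ccontr)
  assume "\<not> ?thesis"
  then have "\<exists>x t. dist u x < inverse (real (Suc n)) \<and> t > real n \<and> J (t *\<^sub>R x) \<ge> 0" for n
    by (metis inverse_positive_iff_positive not_less of_nat_0_less_iff zero_less_Suc)
  then obtain x t where xt: "\<And>n. dist u (x n) < inverse (real (Suc n))"
      "\<And>n. t n > real n" "\<And>n. J (t n *\<^sub>R x n) \<ge> 0"
    by metis
  have "filterlim t at_top sequentially"
    by (rule filterlim_at_top_mono[OF filterlim_real_sequentially])
      (use xt(2) in \<open>auto simp: less_imp_le\<close>)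
  moreover have "x \<longlonglongrightarrow> u"
  proof (rule metric_tendsto_imp_tendsto[OF LIMSEQ_inverse_real_of_nat])
    show "\<forall>\<^sub>F n in sequentially. dist (x n) u \<le> dist (inverse (real (Suc n))) 0"
      using xt(1) by (auto simp: dist_commute less_imp_le)
  qed
  ultimately have "\<forall>\<^sub>F n in sequentially. J (t n *\<^sub>R x n) < 0"
    using neg assms by blast
  then show False using xt(3) by (simp flip: not_le)
qed

text \<open>Along the ray \<open>J\<close> vanishes at the origin, is at least \<open>a\<close> at
  distance \<open>r\<close> and is negative far out. Its maximum is thus attained at some
  \<open>t > 0\<close>, where the radial derivative is zero.\<close>

lemma nehari_meets_ray:
  assumes u: "u \<noteq> 0"
  shows "\<exists>t>0. t *\<^sub>R u \<in> nehari J"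
proof -
  obtain T d where T: "d > 0" "\<And>x t. dist u x < d \<Longrightarrow> t > T \<Longrightarrow> J (t *\<^sub>R x) < 0"
    using locally_neg[OF u] by metis
  define \<rho> where "\<rho> = r / norm u"
  have \<rho>: "\<rho> > 0" using u r by (simp add: \<rho>_def)
  have J\<rho>: "J (\<rho> *\<^sub>R u) \<ge> a"
    by (rule sphere) (use u r in \<open>simp add: \<rho>_def\<close>)
  have \<rho>T: "\<rho> \<le> T"
    using T(2)[of u \<rho>] T(1) J\<rho> a by (cases "\<rho> \<le> T") auto
  have "continuous_on {0..T} (\<lambda>t. J (t *\<^sub>R u))"
    unfolding continuous_on_def by (intro ballI tendsto_J tendsto_intros)
  then obtain t where t: "t \<in> {0..T}" "\<And>s. s \<in> {0..T} \<Longrightarrow> J (s *\<^sub>R u) \<le> J (t *\<^sub>R u)"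
    using \<rho> \<rho>T continuous_attains_sup[of "{0..T}" "\<lambda>t. J (t *\<^sub>R u)"] by auto
  have Jt: "J (t *\<^sub>R u) \<ge> a"
    using t(2)[of \<rho>] \<rho> \<rho>T J\<rho> by simp
  then have t0: "t > 0"
    using t(1) a zero by (cases "t = 0") auto
  \<comment> \<open>Maximality on the whole open half-line makes \<open>t\<close> an interior
    maximum even if \<open>t = T\<close>.\<close>
  have max: "J (s *\<^sub>R u) \<le> J (t *\<^sub>R u)" if "s \<in> {0<..}" for s
    using t(2)[of s] T(2)[of u s] T(1) Jt a that by (cases "s \<le> T") auto
  have "((\<lambda>s. J (s *\<^sub>R u)) has_derivative (\<lambda>h. fderiv J (t *\<^sub>R u) (h *\<^sub>R u))) (at t)"
    by (rule has_derivative_compose[OF _ deriv]) (auto intro!: derivative_eq_intros)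
  from differential_zero_maxmin[OF _ _ this, of "{0<..}"] max t0
  have "(\<lambda>h. fderiv J (t *\<^sub>R u) (h *\<^sub>R u)) = (\<lambda>_. 0)" by auto
  then have "fderiv J (t *\<^sub>R u) (t *\<^sub>R u) = 0" by metis
  then show ?thesis using t0 u by (auto simp: nehari_def)
qed

text \<open>For \<open>u \<noteq> 0\<close> the choice is unique: two admissible values would each
  have to give the strictly larger \<open>J\<close> by \<open>ray_less\<close>. At
  \<open>u = 0\<close> the value is unspecified.\<close>

definition \<tau> :: "'a \<Rightarrow> real" where
  "\<tau> u = (SOME t. t > 0 \<and> t *\<^sub>R u \<in> nehari J)"

lemma \<tau>:
  assumes "u \<noteq> 0"
  shows "\<tau> u > 0" "\<tau> u *\<^sub>R u \<in> nehari J"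
  using someI_ex[OF nehari_meets_ray[OF assms]] by (auto simp: \<tau>_def)

text \<open>A point of the manifold maximizes \<open>J\<close> on its ray, and the ray crosses the
  sphere of radius \<open>r\<close>.\<close>

lemma nehari_ge:
  assumes "u \<in> nehari J"
  shows "a \<le> J u"
proof -
  have u: "u \<noteq> 0" using assms by (simp add: nehari_def)
  have "a \<le> J ((r / norm u) *\<^sub>R u)"
    by (rule sphere) (use u r in simp)
  also have "\<dots> \<le> J u"
    using ray_less[OF assms, of "r / norm u"] u r by (cases "r / norm u = 1") auto
  finally show ?thesis .
qed

text \<open>\<open>ray_less\<close> applies after rescaling by \<open>\<tau> u\<close>. It says
  nothing at \<open>t = 0\<close>, where \<open>J 0 = 0 < a\<close> decides.\<close>

lemma J_ray_less:
  assumes u: "u \<noteq> 0" and t: "t \<ge> 0" "t \<noteq> \<tau> u"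
  shows "J (t *\<^sub>R u) < J (\<tau> u *\<^sub>R u)"
proof (cases "t = 0")
  case True
  then show ?thesis using nehari_ge[OF \<tau>(2)[OF u]] a zero by simp
next
  case False
  then show ?thesis
    using ray_less[OF \<tau>(2)[OF u], of "t / \<tau> u"] \<tau>(1)[OF u] t by simp
qed

lemma J_ray_le: "u \<noteq> 0 \<Longrightarrow> t \<ge> 0 \<Longrightarrow> J (t *\<^sub>R u) \<le> J (\<tau> u *\<^sub>R u)"
  using J_ray_less[of u t] by (cases "t = \<tau> u") auto

text \<open>Since \<open>J\<close> is at least \<open>a\<close> on the manifold,
  \<open>locally_neg\<close> traps \<open>\<tau> x\<close> in a compact interval for
  \<open>x\<close> near \<open>u\<close>. Any limit point of these values maximizes \<open>J\<close>
  on the ray of \<open>u\<close>, so strictness of the maximum forces it to be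
  \<open>\<tau> u\<close>.\<close>

lemma isCont_\<tau>:
  assumes u: "u \<noteq> 0"
  shows "isCont \<tau> u"
proof (rule ccontr)
  assume "\<not> ?thesis"
  then obtain e where e: "e > 0" "\<And>d. d > 0 \<Longrightarrow> \<exists>x. dist x u < d \<and> dist (\<tau> x) (\<tau> u) \<ge> e"
    by (simp add: continuous_at_eps_delta not_less) (metis not_le)
  obtain T d where T: "d > 0" "\<And>x t. dist u x < d \<Longrightarrow> t > T \<Longrightarrow> J (t *\<^sub>R x) < 0"
    using locally_neg[OF u] by metis
  \<comment> \<open>The three bounds secure convergence to \<open>u\<close>, validity of
    \<open>T\<close>, and \<open>x n \<noteq> 0\<close>.\<close>
  have "\<exists>x. dist x u < min (inverse (real (Suc n))) (min d (norm u)) \<and> dist (\<tau> x) (\<tau> u) \<ge> e" for n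
    using u T(1) by (intro e) simp
  then obtain x where x: "\<And>n. dist (x n) u < inverse (real (Suc n))" "\<And>n. dist (x n) u < d"
      "\<And>n. dist (x n) u < norm u" "\<And>n. dist (\<tau> (x n)) (\<tau> u) \<ge> e"
    by (metis min_less_iff_conj)
  have x_nz: "x n \<noteq> 0" for n using x(3)[of n] by auto
  have lim: "x \<longlonglongrightarrow> u"
  proof (rule metric_tendsto_imp_tendsto[OF LIMSEQ_inverse_real_of_nat])
    show "\<forall>\<^sub>F n in sequentially. dist (x n) u \<le> dist (inverse (real (Suc n))) 0"
      using x(1) by (auto simp: less_imp_le)
  qed
  have "\<tau> (x n) \<in> {0..T}" for n
    using \<tau>[OF x_nz[of n]] nehari_ge[OF \<tau>(2)[OF x_nz[of n]]] a T(2)[of "x n" "\<tau> (x n)"] x(2)[of n]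
    by (force simp: dist_commute)
  then obtain l k where l: "l \<in> {0..T}" and k: "strict_mono k" "((\<lambda>n. \<tau> (x n)) \<circ> k) \<longlonglongrightarrow> l"
    using compact_Icc[of 0 T] unfolding compact_def by metis
  have k': "(\<lambda>n. \<tau> (x (k n))) \<longlonglongrightarrow> l" using k(2) by (simp add: o_def)
  have xk: "(\<lambda>n. x (k n)) \<longlonglongrightarrow> u"
    using LIMSEQ_subseq_LIMSEQ[OF lim k(1)] by (simp add: o_def)
  have "J (\<tau> u *\<^sub>R u) \<le> J (l *\<^sub>R u)"
  proof (rule tendsto_le)
    show "((\<lambda>n. J (\<tau> (x (k n)) *\<^sub>R x (k n))) \<longlongrightarrow> J (l *\<^sub>R u)) sequentially"
      by (intro tendsto_J tendsto_intros k' xk)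
    show "((\<lambda>n. J (\<tau> u *\<^sub>R x (k n))) \<longlongrightarrow> J (\<tau> u *\<^sub>R u)) sequentially"
      by (intro tendsto_J tendsto_intros xk)
    show "\<forall>\<^sub>F n in sequentially. J (\<tau> u *\<^sub>R x (k n)) \<le> J (\<tau> (x (k n)) *\<^sub>R x (k n))"
      using \<tau>(1)[OF u] by (intro always_eventually allI J_ray_le x_nz) simp
  qed simp
  moreover have "dist l (\<tau> u) \<ge> e"
    by (rule tendsto_lowerbound[OF tendsto_dist[OF k' tendsto_const]]) (use x(4) in auto)
  ultimately show False
    using J_ray_less[OF u, of l] l e(1) by force
qed

text \<open>By continuity \<open>J\<close> is below \<open>a\<close> near the origin, whereas it is
  at least \<open>a\<close> on the manifold.\<close>

lemma nehari_bounded_below:  "\<exists>d>0. \<forall>u\<in>nehari J. d \<le> norm u"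
proof -
  obtain d where d: "d > 0" "\<And>u. dist u 0 < d \<Longrightarrow> dist (J u) (J 0) < a"
    using isCont_J[of 0] a unfolding continuous_at_eps_delta by blast
  have "d \<le> norm u" if "u \<in> nehari J" for u
    using nehari_ge[OF that] d(2)[of u] zero by (force simp: dist_real_def)
  with d(1) show ?thesis by blast
qed

section \<open>From almost minimizers to almost critical points\<close>

text \<open>Arbitrary directions \<open>w\<close> are tested, not only tangent ones:
  \<open>u + s w\<close> is projected back to the sphere, which costs the factor 2 of
  \<open>dist_sgn_le\<close>.\<close>

lemma norm_fderiv_le:
  assumes u: "norm u = 1" and e: "e \<ge> 0"
    and almost_min: "\<And>v. norm v = 1 \<Longrightarrow> J (\<tau> u *\<^sub>R u) \<le> J (\<tau> v *\<^sub>R v) + e * dist u v"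
  shows "\<tau> u * norm (fderiv J (\<tau> u *\<^sub>R u)) \<le> 2 * e"
proof -
  have u0: "u \<noteq> 0" using u by auto
  have main: "- (2 * e * norm w) \<le> \<tau> u * fderiv J (\<tau> u *\<^sub>R u) w" for w
  proof -
    define s :: "nat \<Rightarrow> real" where "s n = inverse (real (Suc n))" for n
    have s: "s \<longlonglongrightarrow> 0" "s n > 0" for n
      unfolding s_def by (rule LIMSEQ_inverse_real_of_nat) simp
    define y where "y n = u + s n *\<^sub>R w" for n
    have y: "y \<longlonglongrightarrow> u"
      unfolding y_def using tendsto_add[OF tendsto_const tendsto_scaleR[OF s(1) tendsto_const], of u w]
      by simp
    then have y_nz: "\<forall>\<^sub>F n in sequentially. y n \<noteq> 0"
      using u0 by (rule tendsto_imp_eventually_ne)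
    \<comment> \<open>Chosen so that \<open>t n\<close> times \<open>y n\<close> is the manifold
      point on the ray of \<open>y n\<close>.\<close>
    define t where "t n = \<tau> (sgn (y n)) / norm (y n)" for n
    have sgn_u: "sgn u = u" using u by (simp add: sgn_div_norm)
    have "(\<lambda>n. \<tau> (sgn (y n))) \<longlonglongrightarrow> \<tau> u"
      by (rule isCont_tendsto_compose[OF isCont_\<tau>[OF u0]])
        (use tendsto_sgn[OF y u0] sgn_u in simp)
    then have t: "t \<longlonglongrightarrow> \<tau> u"
      unfolding t_def using tendsto_divide[OF _ tendsto_norm[OF y]] u by fastforce
    \<comment> \<open>The base point varies with \<open>n\<close>, so differentiability at the limit
      point alone would not do. The mean value theorem and continuity of \<open>fderiv J\<close>
      replace it.\<close>
    have "\<exists>\<theta>. \<theta> \<in> {0..1} \<and> J (t n *\<^sub>R y n) - J (t n *\<^sub>R u)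
        = fderiv J (t n *\<^sub>R u + (\<theta> * t n * s n) *\<^sub>R w) ((t n * s n) *\<^sub>R w)" for n
    proof -
      define p where "p \<theta> = t n *\<^sub>R u + (\<theta> * t n * s n) *\<^sub>R w" for \<theta>
      have "((\<lambda>\<theta>. J (p \<theta>)) has_derivative (\<lambda>h. fderiv J (p \<theta>) ((h * t n * s n) *\<^sub>R w))) (at \<theta>)" for \<theta>
        unfolding p_def
        by (rule has_derivative_compose[OF _ deriv]) (auto intro!: derivative_eq_intros)
      then have "\<exists>\<theta>\<in>{0..1}. J (p 1) - J (p 0) = fderiv J (p \<theta>) (((1 - 0) * t n * s n) *\<^sub>R w)"
        by (intro mvt_very_simple) (auto intro: has_derivative_at_withinI)
      then show ?thesis by (auto simp: p_def y_def algebra_simps)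
    qed
    then obtain \<theta> where \<theta>: "\<And>n. \<theta> n \<in> {0..1}"
      "\<And>n. J (t n *\<^sub>R y n) - J (t n *\<^sub>R u)
        = fderiv J (t n *\<^sub>R u + (\<theta> n * t n * s n) *\<^sub>R w) ((t n * s n) *\<^sub>R w)"
      by metis
    define \<xi> where "\<xi> n = t n *\<^sub>R u + (\<theta> n * t n * s n) *\<^sub>R w" for n
    have "(\<lambda>n. \<theta> n * (t n * s n)) \<longlonglongrightarrow> 0"
    proof (rule Lim_null_comparison)
      show "(\<lambda>n. norm (t n * s n)) \<longlonglongrightarrow> 0"
        using tendsto_norm_zero[OF tendsto_mult_right_zero[OF s(1)]] tendsto_norm[OF tendsto_mult[OF t s(1)]]
        by simp
      have "norm (\<theta> n * (t n * s n)) \<le> norm (t n * s n)" for n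
        using \<theta>(1)[of n] by (simp add: abs_mult mult_left_le_one_le)
      then show "\<forall>\<^sub>F n in sequentially. norm (\<theta> n * (t n * s n)) \<le> norm (t n * s n)"
        by simp
    qed
    from tendsto_add[OF tendsto_scaleR[OF t tendsto_const] tendsto_scaleR[OF this tendsto_const]]
    have \<xi>: "\<xi> \<longlonglongrightarrow> \<tau> u *\<^sub>R u"
      unfolding \<xi>_def by (simp add: mult.assoc)
    have "isCont (fderiv J) (\<tau> u *\<^sub>R u)"
      using C1 by (simp add: C1_def continuous_on_eq_continuous_at)
    from isCont_tendsto_compose[OF this \<xi>]
    have lim: "(\<lambda>n. t n * fderiv J (\<xi> n) w) \<longlonglongrightarrow> \<tau> u * fderiv J (\<tau> u *\<^sub>R u) w"
      by (intro tendsto_intros t)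
    have "\<forall>\<^sub>F n in sequentially. - (2 * e * norm w) \<le> t n * fderiv J (\<xi> n) w"
      using y_nz
    proof eventually_elim
      case (elim n)
      have sgn_nz: "sgn (y n) \<noteq> 0" using elim by (simp add: sgn_zero_iff)
      have tn: "t n \<ge> 0" using \<tau>(1)[OF sgn_nz] by (simp add: t_def)
      have eq: "t n *\<^sub>R y n = \<tau> (sgn (y n)) *\<^sub>R sgn (y n)"
        by (simp add: t_def sgn_div_norm divide_inverse)
      \<comment> \<open>Replacing \<open>\<tau> u\<close> by \<open>t n\<close> on the ray of
        \<open>u\<close> can only lower \<open>J\<close>. Both sides then carry the same factor
        \<open>t n\<close>, and their difference is the increment treated by the mean value
        theorem.\<close>
      have "J (t n *\<^sub>R u) \<le> J (t n *\<^sub>R y n) + e * dist u (sgn (y n))"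
        using J_ray_le[OF u0 tn] almost_min[of "sgn (y n)"] elim by (simp add: eq norm_sgn)
      moreover have "e * dist u (sgn (y n)) \<le> e * (2 * dist u (y n))"
        by (intro mult_left_mono dist_sgn_le u e)
      moreover have "dist u (y n) = s n * norm w"
        using s(2)[of n] by (simp add: y_def dist_norm)
      moreover have "J (t n *\<^sub>R y n) - J (t n *\<^sub>R u) = s n * (t n * fderiv J (\<xi> n) w)"
        by (simp add: \<theta>(2) \<xi>_def blinfun.scaleR_right)
      ultimately have "s n * - (2 * e * norm w) \<le> s n * (t n * fderiv J (\<xi> n) w)"
        by (simp add: algebra_simps)
      then show ?case using s(2)[of n] by (simp only: mult_le_cancel_left_pos)
    qed
    with lim show ?thesis by (rule tendsto_lowerbound) simp
  qed
  have t: "\<tau> u > 0" by (rule \<tau>[OF u0])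
  have "norm (fderiv J (\<tau> u *\<^sub>R u)) \<le> 2 * e / \<tau> u"
  proof (rule norm_blinfun_bound)
    show "0 \<le> 2 * e / \<tau> u" using t e by simp
    fix w
    \<comment> \<open>The one-sided bound for \<open>w\<close> and for \<open>- w\<close> controls
      the absolute value.\<close>
    have "\<bar>\<tau> u * fderiv J (\<tau> u *\<^sub>R u) w\<bar> \<le> 2 * e * norm w"
      using main[of w] main[of "- w"] by (simp add: blinfun.minus_right abs_le_iff)
    then show "norm (fderiv J (\<tau> u *\<^sub>R u) w) \<le> 2 * e / \<tau> u * norm w"
      using t by (simp add: abs_mult field_simps)
  qed
  then show ?thesis using t by (simp add: field_simps)
qed

text \<open>Ekeland's principle for \<open>J (\<tau> v *\<^sub>R v)\<close> on the unit sphere,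
  started at \<open>sgn u0\<close>. As \<open>norm v = 1\<close>, the factor \<open>\<tau> v\<close>
  in \<open>norm_fderiv_le\<close> is the norm of the manifold point.\<close>

lemma almost_critical_almost_minimizer:
  assumes complete: "complete (sphere 0 1 :: 'a set)"
    and u0: "u0 \<in> nehari J" and e: "e > 0"
  obtains u where "u \<in> nehari J" "J u \<le> J u0" "norm u * norm (fderiv J u) \<le> 2 * e"
proof -
  have u0_nz: "u0 \<noteq> 0" using u0 by (simp add: nehari_def)
  have nz: "v \<noteq> 0" if "v \<in> sphere 0 1" for v :: 'a using that by auto
  have "continuous_on (sphere 0 1) (\<lambda>v. J (\<tau> v *\<^sub>R v))"
    using nz isCont_\<tau> unfolding continuous_on_def isCont_def
    by (intro ballI tendsto_J tendsto_intros) (metis tendsto_within_subset subset_UNIV)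
  moreover have "a \<le> J (\<tau> v *\<^sub>R v)" if "v \<in> sphere 0 1" for v
    by (rule nehari_ge[OF \<tau>(2)[OF nz[OF that]]])
  ultimately obtain v where v: "v \<in> sphere 0 1"
    "J (\<tau> v *\<^sub>R v) \<le> J (\<tau> (sgn u0) *\<^sub>R sgn u0)"
    "\<And>y. y \<in> sphere 0 1 \<Longrightarrow> J (\<tau> v *\<^sub>R v) \<le> J (\<tau> y *\<^sub>R y) + e * dist v y"
    using ekeland_variational_principle[OF complete, of "\<lambda>v. J (\<tau> v *\<^sub>R v)" a "sgn u0" e] e u0_nz
    by (auto simp: norm_sgn)
  show thesis
  proof
    show "\<tau> v *\<^sub>R v \<in> nehari J" by (rule \<tau>[OF nz[OF v(1)]])
    \<comment> \<open>In fact \<open>t = 1\<close>, but \<open>ray_less\<close> gives the required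
      inequality without identifying \<open>t\<close>.\<close>
    define t where "t = \<tau> (sgn u0) / norm u0"
    have "t > 0" using \<tau>(1)[of "sgn u0"] u0_nz by (simp add: t_def sgn_zero_iff)
    then have "J (t *\<^sub>R u0) \<le> J u0"
      using ray_less[OF u0, of t] by (cases "t = 1") auto
    also have "t *\<^sub>R u0 = \<tau> (sgn u0) *\<^sub>R sgn u0"
      by (simp add: t_def sgn_div_norm divide_inverse)
    finally show "J (\<tau> v *\<^sub>R v) \<le> J u0" using v(2) by simp
    show "norm (\<tau> v *\<^sub>R v) * norm (fderiv J (\<tau> v *\<^sub>R v)) \<le> 2 * e"
      using norm_fderiv_le[of v e] v e \<tau>(1)[OF nz[OF v(1)]] by simp
  qed
qed

end

section \<open>Coercivity and the energy functional\<close>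

text \<open>Terms of norm above \<open>n\<close> contradict coercivity. The indices
  \<open>k n\<close> need not increase, since coercivity concerns all sequences in
  \<open>N\<close>.\<close>

lemma coercive_on_bounded:
  assumes coercive: "coercive_on J N" and u: "\<And>n::nat. u n \<in> N" and C: "\<And>n. J (u n) \<le> C"
  shows "bounded (range u)"
proof (rule ccontr)
  assume "\<not> ?thesis"
  then have "\<exists>k. norm (u k) > real n" for n
    by (force simp: bounded_iff not_le)
  then obtain k where k: "\<And>n. norm (u (k n)) > real n" by metis
  have "filterlim (\<lambda>n. norm (u (k n))) at_top sequentially"
    by (rule filterlim_at_top_mono[OF filterlim_real_sequentially])
      (use k in \<open>auto simp: less_imp_le\<close>)
  then have "filterlim (\<lambda>n. J (u (k n))) at_top sequentially"
    using coercive u by (simp add: coercive_on_def)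
  then have "\<forall>\<^sub>F n in sequentially. C < J (u (k n))"
    by (simp add: filterlim_at_top_dense)
  then show False using C by (simp flip: not_le)
qed

lemma C1_energy:
  fixes I :: "'a::real_inner \<Rightarrow> real"
  assumes "C1 I"
  shows "C1 (energy I)"
proof -
  have I: "I differentiable (at u)" for u using assms by (simp add: C1_def)
  have "energy I differentiable (at u)" for u
    unfolding energy_def[abs_def] power2_norm_eq_inner
    by (intro derivative_intros I differentiable_inner differentiable_ident)
  moreover have "continuous_on UNIV (fderiv (energy I))"
  proof -
    \<comment> \<open>The quadratic part contributes the Riesz map, which is bounded linear in
      \<open>u\<close>.\<close>
    have "fderiv (energy I) = (\<lambda>u. blinfun_inner_right u - fderiv I u)"
      by (intro ext blinfun_eqI) (simp add: fderiv_energy[OF assms] blinfun.diff_left)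
    moreover have "continuous_on UNIV (fderiv I)" using assms by (simp add: C1_def)
    ultimately show ?thesis
      using continuous_on_diff linear_continuous_on[OF bounded_linear_blinfun_inner_right] by metis
  qed
  ultimately show ?thesis by (simp add: C1_def)
qed

text \<open>After division by the square of \<open>t n\<close> the quadratic term stays bounded,
  while the term from \<open>I\<close> is eventually larger because \<open>q \<ge> 2\<close> and
  \<open>t n \<ge> 1\<close>.\<close>

lemma energy_eventually_neg:
  fixes I :: "'a::real_inner \<Rightarrow> real"
  assumes t: "filterlim t at_top sequentially" and v: "v \<longlonglongrightarrow> u" and q: "q \<ge> 2"
    and I: "filterlim (\<lambda>n. I (t n *\<^sub>R v n) / t n powr q) at_top sequentially"
  shows "\<forall>\<^sub>F n in sequentially. energy I (t n *\<^sub>R v n) < 0"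
proof -
  \<comment> \<open>The summand 1 puts \<open>M\<close> strictly above the limit of the quadratic
    term.\<close>
  define M where "M = (norm u)\<^sup>2 / 2 + 1"
  have "(\<lambda>n. (norm (v n))\<^sup>2 / 2) \<longlonglongrightarrow> (norm u)\<^sup>2 / 2"
    by (intro tendsto_intros v) simp
  then have "\<forall>\<^sub>F n in sequentially. (norm (v n))\<^sup>2 / 2 < M"
    by (rule order_tendstoD) (simp add: M_def)
  moreover have "\<forall>\<^sub>F n in sequentially. M \<le> I (t n *\<^sub>R v n) / t n powr q"
    using I by (simp add: filterlim_at_top)
  moreover have "\<forall>\<^sub>F n in sequentially. 1 \<le> t n"
    using t by (simp add: filterlim_at_top)
  ultimately show ?thesis
  proof eventually_elim
    case (elim n)
    have "(t n)\<^sup>2 * ((norm (v n))\<^sup>2 / 2) < (t n)\<^sup>2 * M"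
      using elim by (intro mult_strict_left_mono) auto
    also have "\<dots> = t n powr 2 * M"
      using elim by (simp add: powr_numeral)
    also have "\<dots> \<le> t n powr q * M"
      using elim q by (intro mult_right_mono powr_mono) (auto simp: M_def)
    also have "\<dots> \<le> I (t n *\<^sub>R v n)"
      using elim by (simp add: field_simps)
    finally show ?case by (simp add: energy_def power_mult_distrib)
  qed
qed

section \<open>The bounded minimizing sequence\<close>

text \<open>In the zero space \<open>N\<close> is empty and no sequence in it exists, hence
  \<open>nontrivial\<close>. Infima are taken in \<open>ereal\<close>, where they are meaningful for
  every set.\<close>

theorem theorem2p1:
  fixes I J :: "'a::{real_inner, complete_space} \<Rightarrow> real" and N :: "'a set"
  defines "J \<equiv> energy I"
  defines "N \<equiv> nehari J"
  assumes nontrivial: "\<exists>u::'a. u \<noteq> 0"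
    and C1: "C1 I"
    and J1: "\<exists>r>0. (INF u\<in>sphere 0 r. ereal (J u)) > ereal (J 0) \<and> J 0 = 0"
    and J2: "\<exists>q::real. q \<ge> 2 \<and>
      (\<forall>(t :: nat \<Rightarrow> real) (v :: nat \<Rightarrow> 'a) u.
         filterlim t at_top sequentially \<longrightarrow> v \<longlonglongrightarrow> u \<longrightarrow> u \<noteq> 0 \<longrightarrow>
         filterlim (\<lambda>n. I (t n *\<^sub>R v n) / t n powr q) at_top sequentially)"
    and J3: "\<forall>t\<in>{0<..} - {1}. \<forall>u\<in>N.
      (t\<^sup>2 - 1) / 2 * blinfun_apply (fderiv I u) u - I (t *\<^sub>R u) + I u < 0"
    and J4: "coercive_on J N"
  shows "(INF u\<in>N. ereal (J u)) > 0 \<and>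
    (\<exists>u :: nat \<Rightarrow> 'a. bounded (range u) \<and> (\<forall>n. u n \<in> N) \<and>
       (\<lambda>n. ereal (J (u n))) \<longlonglongrightarrow> (INF u\<in>N. ereal (J u)) \<and>
       (\<lambda>n. fderiv J (u n)) \<longlonglongrightarrow> 0)"
proof -
  obtain r where r: "r > 0" "(INF u\<in>sphere 0 r. ereal (J u)) > 0" and J0: "J 0 = 0"
    using J1 by (auto simp: zero_ereal_def)
  then obtain a where a: "a > 0" "ereal a < (INF u\<in>sphere 0 r. ereal (J u))"
    using ereal_dense2[of 0] by (auto simp: zero_ereal_def)
  interpret nehari_functional J r a
  proof
    show "C1 J" unfolding J_def by (rule C1_energy[OF C1])
    fix u :: 'a assume "norm u = r"
    then have "(INF u\<in>sphere 0 r. ereal (J u)) \<le> ereal (J u)" by (intro INF_lower) simp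
    with a(2) have "ereal a < ereal (J u)" by (rule less_le_trans)
    then show "a \<le> J u" by simp
  next
    fix t :: "nat \<Rightarrow> real" and v and u :: 'a
    assume "filterlim t at_top sequentially" "v \<longlonglongrightarrow> u" "u \<noteq> 0"
    then show "\<forall>\<^sub>F n in sequentially. J (t n *\<^sub>R v n) < 0"
      unfolding J_def using J2 by (blast intro: energy_eventually_neg)
  next
    \<comment> \<open>On \<open>N\<close> the identity for the squared norm turns the left-hand side
      of (J3) into \<open>J (t *\<^sub>R u) - J u\<close>.\<close>
    fix u t assume u: "u \<in> nehari J" and t: "0 < t" "t \<noteq> (1::real)"
    have "(norm u)\<^sup>2 = fderiv I u u"
      using u unfolding J_def nehari_energy[OF C1] by simp
    moreover have "(t\<^sup>2 - 1) / 2 * fderiv I u u - I (t *\<^sub>R u) + I u < 0"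
      using J3 u t unfolding N_def by blast
    ultimately show "J (t *\<^sub>R u) < J u"
      by (simp add: J_def energy_def power_mult_distrib field_simps)
  qed (use J0 r a in auto)
  define c where "c = Inf (J ` N)"
  have N: "N \<noteq> {}" using nontrivial nehari_meets_ray unfolding N_def by blast
  have bdd: "bdd_below (J ` N)" using nehari_ge by (auto simp: N_def intro!: bdd_belowI[of _ a])
  have c_le: "c \<le> J u" if "u \<in> N" for u
    unfolding c_def using that by (intro cInf_lower bdd) simp
  have INF_eq: "(INF u\<in>N. ereal (J u)) = ereal c"
    using ereal_Inf'[OF bdd] N unfolding c_def by (simp add: image_image)
  have "c \<ge> a"
    unfolding c_def using N nehari_ge by (intro cInf_greatest) (auto simp: N_def)
  then have c: "c > 0" using a by simp
  obtain d where d: "d > 0" "\<And>u. u \<in> N \<Longrightarrow> d \<le> norm u"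
    using nehari_bounded_below unfolding N_def by blast
  have "\<exists>u\<in>N. J u \<le> c + inverse (real (Suc n)) \<and> norm (fderiv J u) \<le> 2 / d * inverse (real (Suc n))" for n
  proof -
    define e where "e = inverse (real (Suc n))"
    have e: "e > 0" by (simp add: e_def)
    obtain u0 where u0: "u0 \<in> N" "J u0 < c + e"
      using cInf_lessD[of "J ` N" "c + e"] N e unfolding c_def by auto
    have "closed {x::'a. norm x = 1}"
      by (intro closed_Collect_eq continuous_intros)
    then have "complete (sphere 0 1 :: 'a set)"
      by (simp add: complete_eq_closed sphere_def)
    then obtain u where u: "u \<in> N" "J u \<le> J u0" "norm u * norm (fderiv J u) \<le> 2 * e"
      using almost_critical_almost_minimizer[OF _ _ e] u0(1) unfolding N_def by blast
    \<comment> \<open>The distance \<open>d\<close> of the manifold from the origin turns the scaled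
      estimate into one for the derivative alone.\<close>
    have "d * norm (fderiv J u) \<le> norm u * norm (fderiv J u)"
      using d(2)[OF u(1)] by (intro mult_right_mono) auto
    then have "norm (fderiv J u) \<le> 2 / d * e"
      using u(3) d(1) by (simp add: field_simps)
    then show ?thesis using u u0 unfolding e_def by force
  qed
  then obtain u where u: "\<And>n. u n \<in> N" "\<And>n. J (u n) \<le> c + inverse (real (Suc n))"
      "\<And>n. norm (fderiv J (u n)) \<le> 2 / d * inverse (real (Suc n))"
    by metis
  have "bounded (range u)"
  proof (rule coercive_on_bounded[OF J4 u(1)])
    fix n
    have "inverse (real (Suc n)) \<le> 1" by (simp add: inverse_le_1_iff)
    then show "J (u n) \<le> c + 1" using u(2)[of n] by simp
  qed
  moreover have "(\<lambda>n. J (u n)) \<longlonglongrightarrow> c"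
  proof (rule tendsto_sandwich[OF _ _ tendsto_const])
    show "(\<lambda>n. c + inverse (real (Suc n))) \<longlonglongrightarrow> c"
      using tendsto_add[OF tendsto_const LIMSEQ_inverse_real_of_nat, of c] by simp
  qed (use c_le u in auto)
  moreover have "(\<lambda>n. fderiv J (u n)) \<longlonglongrightarrow> 0"
  proof (rule Lim_null_comparison)
    show "(\<lambda>n. 2 / d * inverse (real (Suc n))) \<longlonglongrightarrow> 0"
      by (rule tendsto_mult_right_zero[OF LIMSEQ_inverse_real_of_nat])
  qed (use u(3) in simp)
  ultimately show ?thesis using u(1) c unfolding INF_eq by auto
qed

end
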